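(* Let $n \ge 1$ be an integer, let $\mathcal{F}$ be the set of all partial orders on $[n]=\{1,\dots,n\}$, and let $\mathcal{G}\subseteq\mathcal{F}$ be the set of all total orders on $[n]$. Regard $\mathcal{G}$ as a family of subsets of the ground set $\mathcal{F}$ by identifying each $B\in\mathcal{G}$ with the set $\{A\in\mathcal{F} : A \text{ is compatible with } B\}$. Then the VC-dimension $\mathrm{VC}_{\mathcal{F}}(\mathcal{G})$ of this set family satisfies \[ 2(n-3) \le \mathrm{VC}_{\mathcal{F}}(\mathcal{G}) \le n\log_2 n. \]
   Context: Two partial orders $<_1,<_2$ on $[n]$ are called compatible if there exists a partial order on $[n]$ finer than both (i.e. containing both relations), equivalently if the directed graph on $[n]$ whose edge set is $<_1\cup<_2$ (an edge $a\to b$ whenever $a<_1 b$ or $a<_2 b$) is acyclic. The empty relation counts as a partial order. For a family $\mathcal{H}$ of subsets of a set $X$, a subset $S\subseteq X$ is shattered by $\mathcal{H}$ if for every $A\subseteq S$ there is $B\in\mathcal{H}$ with $B\cap S=A$; the VC-dimension of $\mathcal{H}$ on $X$ is the largest cardinality of a subset of $X$ shattered by $\mathcal{H}$. Here $\mathrm{VC}_{\mathcal{F}}(\mathcal{G})$ denotes the VC-dimension of the family $\{\{A\in\mathcal{F}: A \text{ compatible with } B\} : B\in\mathcal{G}\}$ on the ground set $\mathcal{F}$. *)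

theory Defs
  imports Complex_Main
begin

(* Partial orders are strict, so that the empty relation is one of them. *)

definition partial_orders :: "'a set \<Rightarrow> 'a rel set" where
  "partial_orders V = {r. r \<subseteq> V \<times> V \<and> irrefl r \<and> trans r}"

definition total_orders :: "'a set \<Rightarrow> 'a rel set" where
  "total_orders V = {r \<in> partial_orders V. total_on V r}"

definition compatible :: "'a set \<Rightarrow> 'a rel \<Rightarrow> 'a rel \<Rightarrow> bool" where
  "compatible V r s \<longleftrightarrow> (\<exists>t \<in> partial_orders V. r \<subseteq> t \<and> s \<subseteq> t)"

lemma compatible_iff_acyclic:
  assumes "r \<in> partial_orders V" "s \<in> partial_orders V"
  shows "compatible V r s \<longleftrightarrow> acyclic (r \<union> s)"
proof
  assume "compatible V r s"
  then obtain t where "r \<union> s \<subseteq> t" "irrefl t" "trans t"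
    unfolding compatible_def partial_orders_def by blast
  moreover from this have "acyclic t"
    unfolding acyclic_irrefl by (simp only: trancl_id)
  ultimately show "acyclic (r \<union> s)"
    using acyclic_subset by blast
next
  assume ac: "acyclic (r \<union> s)"
  have "r \<union> s \<subseteq> V \<times> V"
    using assms unfolding partial_orders_def by blast
  then have "(r \<union> s)\<^sup>+ \<subseteq> V \<times> V"
    by (rule trancl_subset_Sigma)
  then have "(r \<union> s)\<^sup>+ \<in> partial_orders V"
    using ac trans_trancl unfolding partial_orders_def acyclic_irrefl by blast
  moreover have "r \<subseteq> (r \<union> s)\<^sup>+" "s \<subseteq> (r \<union> s)\<^sup>+"
    by auto
  ultimately show "compatible V r s"
    unfolding compatible_def by blast
qed

definition shattered :: "'b set set \<Rightarrow> 'b set \<Rightarrow> bool" where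
  "shattered H S \<longleftrightarrow> (\<forall>A \<subseteq> S. \<exists>B \<in> H. B \<inter> S = A)"

(* Meaningful when H is nonempty and the cardinalities are bounded, e.g. X finite;
   see the two lemmas below. *)
definition VC_dim :: "'b set \<Rightarrow> 'b set set \<Rightarrow> nat" where
  "VC_dim X H = (GREATEST d. \<exists>S \<subseteq> X. finite S \<and> shattered H S \<and> card S = d)"

lemma VC_dim_attained:
  assumes "finite X" "H \<noteq> {}"
  shows "\<exists>S \<subseteq> X. finite S \<and> shattered H S \<and> card S = VC_dim X H"
  unfolding VC_dim_def
proof (rule GreatestI_nat)
  show "\<exists>S \<subseteq> X. finite S \<and> shattered H S \<and> card S = 0"
    using assms(2) by (intro exI[of _ "{}"]) (simp add: shattered_def ex_in_conv)
  show "d \<le> card X" if "\<exists>S \<subseteq> X. finite S \<and> shattered H S \<and> card S = d" for d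
    using that assms(1) card_mono by blast
qed

lemma card_le_VC_dim:
  assumes "finite X" "S \<subseteq> X" "shattered H S"
  shows "card S \<le> VC_dim X H"
  unfolding VC_dim_def
proof (rule Greatest_le_nat)
  show "\<exists>T \<subseteq> X. finite T \<and> shattered H T \<and> card T = card S"
    using assms finite_subset by blast
  show "d \<le> card X" if "\<exists>T \<subseteq> X. finite T \<and> shattered H T \<and> card T = d" for d
    using that assms(1) card_mono by blast
qed

definition compatible_sets :: "'a set \<Rightarrow> 'a rel set set" where
  "compatible_sets V = (\<lambda>B. {A \<in> partial_orders V. compatible V A B}) ` total_orders V"

end

theory Submission
  imports Defs "HOL-Library.FuncSet"
begin

text \<open>
  A partial order is compatible with a total order \<open>B\<close> iff it is contained in \<open>B\<close>. For the lower
  bound, fix three points \<open>a\<close>, \<open>b\<close>, \<open>c\<close>. Every other point \<open>x\<close> contributes the two orders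
  \<open>a < x < c\<close> and \<open>b < x\<close>. Over the chain \<open>a < b < c\<close>, the four positions of \<open>x\<close> realise the four
  patterns of compatibility with these two orders, and the points \<open>x\<close> can be placed independently.
  For the upper bound, a family that shatters \<open>d\<close> points has at least \<open>2 ^ d\<close> members, and there are
  at most \<open>n ^ n\<close> total orders.
\<close>

text \<open>If a pair of \<open>A\<close> is missing from \<open>B\<close>, totality puts the
  reversed pair into \<open>B\<close>, and a common extension would contain both, hence a loop by
  transitivity.\<close>

lemma compatible_total_iff_subset:
  assumes "A \<in> partial_orders V" "B \<in> total_orders V"
  shows "compatible V A B \<longleftrightarrow> A \<subseteq> B"
proof
  assume "A \<subseteq> B"
  then show "compatible V A B"
    using assms unfolding compatible_def total_orders_def by blast
next
  assume "compatible V A B"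
  then obtain t where t: "irrefl t" "trans t" "A \<subseteq> t" "B \<subseteq> t"
    unfolding compatible_def partial_orders_def by blast
  show "A \<subseteq> B"
  proof (rule subrelI, rule ccontr)
    fix u v assume uv: "(u, v) \<in> A" "(u, v) \<notin> B"
    have "u \<in> V" "v \<in> V" "u \<noteq> v"
      using uv(1) assms(1) unfolding partial_orders_def irrefl_def by auto
    then have "(v, u) \<in> B"
      using uv(2) assms(2) unfolding total_orders_def total_on_def by blast
    then have "(u, u) \<in> t"
      using uv(1) t by (meson subsetD transD)
    then show False
      using t(1) unfolding irrefl_def by blast
  qed
qed

lemma finite_partial_orders: "finite V \<Longrightarrow> finite (partial_orders V)"
  unfolding partial_orders_def by (rule finite_subset[of _ "Pow (V \<times> V)"]) auto

text \<open>Ties are broken by the order of the type, so \<open>g\<close> need not be injective for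
  the result to be total.\<close>

definition key_order :: "'a::linorder set \<Rightarrow> ('a \<Rightarrow> 'b::linorder) \<Rightarrow> 'a rel" where
  "key_order V g = {(u, v) \<in> V \<times> V. g u < g v \<or> g u = g v \<and> u < v}"

lemma key_order_total: "key_order V g \<in> total_orders V"
  unfolding key_order_def total_orders_def partial_orders_def irrefl_def trans_def total_on_def
  by auto

text \<open>Intersecting with a largest shattered set \<open>S\<close> maps \<open>H\<close> onto
  \<open>Pow S\<close>.\<close>

lemma two_power_VC_dim_le_card:
  assumes "finite X" "finite H" "H \<noteq> {}"
  shows "2 ^ VC_dim X H \<le> card H"
proof -
  obtain S where S: "finite S" "shattered H S" "card S = VC_dim X H"
    using VC_dim_attained[OF assms(1,3)] by blast
  have "Pow S \<subseteq> (\<lambda>B. B \<inter> S) ` H"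
    using S(2) unfolding shattered_def by blast
  then have "card (Pow S) \<le> card H"
    using assms(2) by (rule surj_card_le[rotated])
  then show ?thesis
    using S by (simp add: card_Pow)
qed

text \<open>A total order is determined by the number of predecessors of each point, a function from
  \<open>V\<close> to numbers below \<open>card V\<close>.\<close>

lemma card_total_orders_le:
  assumes "finite V"
  shows "card (total_orders V) \<le> card V ^ card V"
proof -
  define rank where "rank r = (\<lambda>x\<in>V. card {y. (y, x) \<in> r})" for r :: "'a rel"
  have rank_less: "rank r x < rank r y"
    if "r \<in> partial_orders V" "(x, y) \<in> r" for r x y
  proof -
    have r: "r \<subseteq> V \<times> V" "irrefl r" "trans r"
      using that(1) unfolding partial_orders_def by auto
    \<comment> \<open>The inclusion is transitivity; it is strict because \<open>x\<close> precedes
      \<open>y\<close> but not itself.\<close>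
    have "{z. (z, x) \<in> r} \<subset> {z. (z, y) \<in> r}"
      using that(2) r unfolding irrefl_def by (auto dest: transD)
    moreover have "finite {z. (z, y) \<in> r}"
      using r(1) by (auto intro: finite_subset[OF _ assms])
    ultimately show ?thesis
      using that(2) r(1) psubset_card_mono by (auto simp: rank_def)
  qed
  have rank_less_iff: "(x, y) \<in> r \<longleftrightarrow> rank r x < rank r y"
    if "r \<in> total_orders V" "x \<in> V" "y \<in> V" for r x y
  proof -
    have r: "r \<in> partial_orders V" "(x, y) \<in> r \<or> x = y \<or> (y, x) \<in> r"
      using that unfolding total_orders_def total_on_def by blast+
    then show ?thesis
      using rank_less[OF r(1), of x y] rank_less[OF r(1), of y x] by auto
  qed
  have "inj_on rank (total_orders V)"
  proof (rule inj_onI)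
    fix r s assume rs: "r \<in> total_orders V" "s \<in> total_orders V" "rank r = rank s"
    then have "r \<subseteq> V \<times> V" "s \<subseteq> V \<times> V"
      unfolding total_orders_def partial_orders_def by auto
    then show "r = s"
      using rank_less_iff[OF rs(1)] rank_less_iff[OF rs(2)] rs(3) by (auto 4 3)
  qed
  moreover have "rank ` total_orders V \<subseteq> V \<rightarrow>\<^sub>E {..<card V}"
  proof (rule image_subsetI)
    fix r assume "r \<in> total_orders V"
    then have r: "r \<subseteq> V \<times> V" "irrefl r"
      unfolding total_orders_def partial_orders_def by auto
    have "card {y. (y, x) \<in> r} < card V" if "x \<in> V" for x
      using that r by (intro psubset_card_mono assms) (auto simp: irrefl_def)
    then show "rank r \<in> V \<rightarrow>\<^sub>E {..<card V}"
      by (simp add: rank_def)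
  qed
  ultimately have "card (total_orders V) \<le> card (V \<rightarrow>\<^sub>E {..<card V})"
    using assms by (intro card_inj_on_le) (auto intro: finite_PiE)
  then show ?thesis
    using assms by (simp add: card_PiE)
qed

lemma VC_dim_compatible_upper:
  fixes V :: "'a::linorder set"
  assumes "finite V" "V \<noteq> {}"
  shows "real (VC_dim (partial_orders V) (compatible_sets V)) \<le> card V * log 2 (card V)"
proof -
  let ?d = "VC_dim (partial_orders V) (compatible_sets V)"
  have fin: "finite (total_orders V)"
    using finite_partial_orders[OF assms(1)] unfolding total_orders_def by simp
  have "2 ^ ?d \<le> card (compatible_sets V)"
    \<comment> \<open>The order keyed by \<open>id\<close> witnesses that the family is
      nonempty.\<close>
    using fin key_order_total[of V id]
    by (intro two_power_VC_dim_le_card finite_partial_orders assms) (auto simp: compatible_sets_def)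
  also have "\<dots> \<le> card (total_orders V)"
    unfolding compatible_sets_def by (rule card_image_le[OF fin])
  also have "\<dots> \<le> card V ^ card V"
    by (rule card_total_orders_le[OF assms(1)])
  finally have "real (2 ^ ?d) \<le> real (card V ^ card V)"
    by (rule of_nat_mono)
  moreover have "0 < card V"
    using assms by (simp add: card_gt_0_iff)
  ultimately have "log 2 (2 ^ ?d) \<le> log 2 (real (card V) ^ card V)"
    by (subst log_le_cancel_iff) auto
  then show ?thesis
    using \<open>0 < card V\<close> by (simp add: log_nat_power)
qed

lemma VC_dim_compatible_lower:
  fixes V :: "'a::linorder set"
  assumes "finite V" "{a, b, c} \<subseteq> V" "distinct [a, b, c]"
  shows "2 * (card V - 3) \<le> VC_dim (partial_orders V) (compatible_sets V)"
proof -
  define W where "W = V - {a, b, c}"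
  \<comment> \<open>The pair \<open>(a, c)\<close> makes the chain through \<open>x\<close>
    transitive.\<close>
  define P where "P x = {(a, x), (x, c), (a, c)}" for x
  define Q where "Q x = {(b, x)}" for x :: 'a
  define S where "S = P ` W \<union> Q ` W"
  have "inj_on P W" "inj_on Q W" "P ` W \<inter> Q ` W = {}"
    using assms(3) by (auto simp: P_def Q_def W_def inj_on_def)
  moreover have "finite W"
    using assms(1) by (simp add: W_def)
  ultimately have "card S = 2 * card W"
    by (simp add: S_def card_Un_disjoint card_image)
  also have "card W = card V - 3"
    using assms by (simp add: W_def card_Diff_subset)
  finally have card_S: "card S = 2 * (card V - 3)" .
  have S: "S \<subseteq> partial_orders V"
    using assms
    by (auto simp: S_def P_def Q_def W_def partial_orders_def irrefl_def trans_def)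
  have "shattered (compatible_sets V) S"
    unfolding shattered_def
  proof (intro allI impI)
    fix A assume "A \<subseteq> S"
    \<comment> \<open>The keys of \<open>a\<close>, \<open>b\<close>, \<open>c\<close> will be 2, 4,
      6, and the odd values are the gaps around them: 1 satisfies neither order, 3 only
      \<open>P x\<close>, 5 both, 7 only \<open>Q x\<close>.\<close>
    define pos :: "'a \<Rightarrow> nat" where
      "pos x = (if P x \<in> A then if Q x \<in> A then 5 else 3 else if Q x \<in> A then 7 else 1)" for x
    define g :: "'a \<Rightarrow> nat" where
      "g x = (if x = a then 2 else if x = b then 4 else if x = c then 6 else pos x)" for x
    define B where "B = key_order V g"
    have B: "B \<in> total_orders V"
      unfolding B_def by (rule key_order_total)
    \<comment> \<open>Odd keys never tie with 2, 4, 6, so ties occur only within \<open>W\<close>,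
      and neither \<open>P x\<close> nor \<open>Q x\<close> relates two points of
      \<open>W\<close>.\<close>
    have PQ: "(P x \<subseteq> B \<longleftrightarrow> P x \<in> A) \<and> (Q x \<subseteq> B \<longleftrightarrow> Q x \<in> A)" if "x \<in> W" for x
    proof -
      have "g a = 2" "g b = 4" "g c = 6" "g x = pos x" "x \<in> V"
        using that assms(3) by (auto simp: g_def W_def)
      then have "P x \<subseteq> B \<longleftrightarrow> pos x \<in> {3, 5}" "Q x \<subseteq> B \<longleftrightarrow> pos x \<in> {5, 7}"
        using assms(2) by (auto simp: P_def Q_def B_def key_order_def pos_def split: if_splits)
      then show ?thesis
        by (simp add: pos_def)
    qed
    have "{R \<in> partial_orders V. compatible V R B} \<inter> S = {R \<in> S. R \<subseteq> B}"
      using S compatible_total_iff_subset[OF _ B] by blast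
    also have "\<dots> = A"
      using \<open>A \<subseteq> S\<close> PQ by (auto simp: S_def)
    finally show "\<exists>C\<in>compatible_sets V. C \<inter> S = A"
      using B unfolding compatible_sets_def by blast
  qed
  then show ?thesis
    using card_le_VC_dim[OF finite_partial_orders[OF assms(1)] S] card_S by simp
qed

theorem theorem2:
  fixes n :: nat
  assumes "n \<ge> 1"
  shows "2 * (real n - 3) \<le> real (VC_dim (partial_orders {1..n}) (compatible_sets {1..n}))
       \<and> real (VC_dim (partial_orders {1..n}) (compatible_sets {1..n})) \<le> real n * log 2 (real n)"
proof
  show "2 * (real n - 3) \<le> real (VC_dim (partial_orders {1..n}) (compatible_sets {1..n}))"
  \<comment> \<open>For \<open>n\<close> below 3 the real left-hand side is negative; from 3 on,
    subtraction on \<open>nat\<close> agrees with the real one.\<close>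
  proof (cases "n \<ge> 3")
    case True
    then have "2 * (n - 3) \<le> VC_dim (partial_orders {1..n}) (compatible_sets {1..n})"
      using VC_dim_compatible_lower[of "{1..n}" 1 2 3] by simp
    then have "real (2 * (n - 3)) \<le> real (VC_dim (partial_orders {1..n}) (compatible_sets {1..n}))"
      by (rule of_nat_mono)
    then show ?thesis
      using True by simp
  qed simp
  show "real (VC_dim (partial_orders {1..n}) (compatible_sets {1..n})) \<le> real n * log 2 (real n)"
    using VC_dim_compatible_upper[of "{1..n}"] assms by simp
qed

end
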